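(* Given points $p_1,\ldots,p_r\in\mathbb{P}^d$ and fat point subschemes $Z=m_1'p_1+\cdots+m_r'p_r$ and $Y=m_1p_1+\cdots+m_rp_r$ of $\mathbb{P}^d$ with $m_i'>m_i$ for all $i$ whenever $m_i'>0$, assume that $\mathrm{char}(K)$ is either $0$ or bigger than the degree of each generator in a minimal set of homogeneous generators of $I(Z)$. Then $I(Z)\subset R_1I(Y)$.
   Context: $K$ is an algebraically closed field of arbitrary characteristic (subject to the assumption in the claim). Here $R=K[\mathbb{P}^d]$ is the homogeneous coordinate ring of $\mathbb{P}^d$ over $K$, i.e. a polynomial ring in $d+1$ variables with the standard grading; $R_1$ is the $K$-vector space of linear forms in $R$, and for an ideal $J\subset R$, $R_1J$ denotes the ideal generated by all products of a linear form and an element of $J$. The multiplicities $m_i$ and $m_i'$ are nonnegative integers. The fat point subscheme $W=a_1p_1+\cdots+a_rp_r\subset\mathbb{P}^d$ (with nonnegative integers $a_j$) has ideal $I(W)=I_1^{a_1}\cap\cdots\cap I_r^{a_r}\subset R$, where $I_j$ is the ideal generated by all forms in $R$ vanishing at $p_j$ (and $I_j^0=(1)$).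
   Formalization: The formal statement adds that m_i = 0 whenever m_i' = 0, and that some m_i' > 0 (Z is nonempty); without these the claim is false, e.g. for Z = q, Y = p with p, q distinct, or for Z empty, where I(Z) = R. *)

theory Defs
  imports "HOL-Library.Poly_Mapping" "HOL-Computational_Algebra.Polynomial"
begin

text \<open>
  The homogeneous coordinate ring of projective \<open>d\<close>-space over \<open>'k\<close>: polynomials in variables
  indexed by a finite type \<open>'n\<close> with \<open>CARD('n) = d + 1\<close>. As \<open>'n\<close> is an arbitrary (nonempty)
  finite type, \<open>d \<ge> 0\<close> is arbitrary. Multiplication on \<open>poly_mapping\<close> is convolution, so this
  is the monoid algebra of the exponent vectors, i.e. the polynomial ring.
\<close>

type_synonym ('k, 'n) mpoly = "('n \<Rightarrow>\<^sub>0 nat) \<Rightarrow>\<^sub>0 'k"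

definition monomial_degree :: "('n::finite \<Rightarrow>\<^sub>0 nat) \<Rightarrow> nat" where
  "monomial_degree e = (\<Sum>i\<in>UNIV. Poly_Mapping.lookup e i)"

text \<open>The zero polynomial is homogeneous of every degree; \<open>total_degree\<close> sends it to \<open>0\<close>.\<close>

definition homogeneous :: "nat \<Rightarrow> ('k::zero, 'n::finite) mpoly \<Rightarrow> bool" where
  "homogeneous t f \<longleftrightarrow> (\<forall>e\<in>Poly_Mapping.keys f. monomial_degree e = t)"

definition total_degree :: "('k::zero, 'n::finite) mpoly \<Rightarrow> nat" where
  "total_degree f = Max (insert 0 (monomial_degree ` Poly_Mapping.keys f))"

definition linear_forms :: "('k::zero, 'n::finite) mpoly set" where
  "linear_forms = {f. homogeneous 1 f}"

definition eval_at :: "('n::finite \<Rightarrow> 'k::comm_semiring_1) \<Rightarrow> ('k, 'n) mpoly \<Rightarrow> 'k" where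
  "eval_at v f = (\<Sum>e\<in>Poly_Mapping.keys f. Poly_Mapping.lookup f e * (\<Prod>i\<in>UNIV. v i ^ Poly_Mapping.lookup e i))"

lemma eval_at_scale:
  assumes "homogeneous t f"
  shows "eval_at (\<lambda>i. c * v i) f = c ^ t * eval_at v f"
proof -
  have "Poly_Mapping.lookup f e * (\<Prod>i\<in>UNIV. (c * v i) ^ Poly_Mapping.lookup e i)
      = c ^ t * (Poly_Mapping.lookup f e * (\<Prod>i\<in>UNIV. v i ^ Poly_Mapping.lookup e i))" if "e \<in> Poly_Mapping.keys f" for e
  proof -
    have "(\<Sum>i\<in>UNIV. Poly_Mapping.lookup e i) = t"
      using assms that by (simp add: homogeneous_def monomial_degree_def)
    then show ?thesis
      by (simp add: power_mult_distrib prod.distrib power_sum[symmetric] mult.left_commute)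
  qed
  then show ?thesis
    by (simp add: eval_at_def sum_distrib_left)
qed


text \<open>
  Points of projective space: nonzero coordinate vectors modulo nonzero scalars.
\<close>

definition proportional :: "('n \<Rightarrow> 'k::field) \<Rightarrow> ('n \<Rightarrow> 'k) \<Rightarrow> bool" where
  "proportional u v \<longleftrightarrow>
     u \<noteq> (\<lambda>_. 0) \<and> v \<noteq> (\<lambda>_. 0) \<and> (\<exists>c. c \<noteq> 0 \<and> v = (\<lambda>i. c * u i))"

lemma part_equivp_proportional:
  "part_equivp (proportional :: ('n \<Rightarrow> 'k::field) \<Rightarrow> ('n \<Rightarrow> 'k) \<Rightarrow> bool)"
proof (rule part_equivpI)
  have "proportional (\<lambda>_::'n. 1::'k) (\<lambda>_. 1)"
    by (auto simp: proportional_def fun_eq_iff intro!: exI[of _ 1])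
  then show "\<exists>v :: 'n \<Rightarrow> 'k. proportional v v" by blast
  show "symp (proportional :: ('n \<Rightarrow> 'k) \<Rightarrow> _)"
  proof (rule sympI)
    fix u v :: "'n \<Rightarrow> 'k"
    assume "proportional u v"
    then obtain c where c: "u \<noteq> (\<lambda>_. 0)" "v \<noteq> (\<lambda>_. 0)" "c \<noteq> 0" "v = (\<lambda>i. c * u i)"
      by (auto simp: proportional_def)
    have "u = (\<lambda>i. inverse c * v i)"
      using c(3,4) by (simp add: fun_eq_iff mult.assoc[symmetric])
    moreover have "inverse c \<noteq> 0"
      using c(3) by simp
    ultimately show "proportional v u"
      unfolding proportional_def using c(1,2) by blast
  qed
  show "transp (proportional :: ('n \<Rightarrow> 'k) \<Rightarrow> _)"
  proof (rule transpI)
    fix u v w :: "'n \<Rightarrow> 'k"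
    assume "proportional u v" "proportional v w"
    then obtain c d where c: "u \<noteq> (\<lambda>_. 0)" "c \<noteq> 0" "v = (\<lambda>i. c * u i)"
      and d: "w \<noteq> (\<lambda>_. 0)" "d \<noteq> 0" "w = (\<lambda>i. d * v i)"
      by (auto simp: proportional_def)
    have "w = (\<lambda>i. (d * c) * u i)"
      using c(3) d(3) by (simp add: fun_eq_iff mult.assoc)
    moreover have "d * c \<noteq> 0"
      using c(2) d(2) by simp
    ultimately show "proportional u w"
      unfolding proportional_def using c(1) d(1) by blast
  qed
qed

quotient_type (overloaded) ('k, 'n) proj_space = "'n \<Rightarrow> 'k::field" / partial: proportional
  by (rule part_equivp_proportional)

lift_definition forms_vanishing_at :: "('k::field, 'n::finite) proj_space \<Rightarrow> ('k, 'n) mpoly set"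
  is "\<lambda>v. {f. (\<exists>t. homogeneous t f) \<and> eval_at v f = 0}"
  by (auto simp: proportional_def eval_at_scale)


text \<open>Ideals of a commutative ring are its submodules as a module over itself.\<close>

definition ideal_generated_by :: "'a::comm_ring_1 set \<Rightarrow> 'a set" where
  "ideal_generated_by S = module.span (*) S"

lemma module_self: "module ((*) :: 'a::comm_ring_1 \<Rightarrow> 'a \<Rightarrow> 'a)"
  by unfold_locales (simp_all add: algebra_simps)

definition ideal_product :: "'a::comm_ring_1 set \<Rightarrow> 'a set \<Rightarrow> 'a set" where
  "ideal_product S T = ideal_generated_by {s * t | s t. s \<in> S \<and> t \<in> T}"

primrec ideal_power :: "'a::comm_ring_1 set \<Rightarrow> nat \<Rightarrow> 'a set" where
  "ideal_power I 0 = UNIV"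
| "ideal_power I (Suc a) = ideal_product I (ideal_power I a)"

definition minimal_homogeneous_generators ::
    "('k::comm_ring_1, 'n::finite) mpoly set \<Rightarrow> ('k, 'n) mpoly set \<Rightarrow> bool" where
  "minimal_homogeneous_generators G J \<longleftrightarrow>
     (\<forall>g\<in>G. \<exists>t. homogeneous t g) \<and> ideal_generated_by G = J \<and>
     (\<forall>H. H \<subset> G \<longrightarrow> ideal_generated_by H \<noteq> J)"


definition point_ideal :: "('k::field, 'n::finite) proj_space \<Rightarrow> ('k, 'n) mpoly set" where
  "point_ideal P = ideal_generated_by (forms_vanishing_at P)"

text \<open>The ideal of the fat point subscheme \<open>a\<^sub>1 p\<^sub>1 + \<dots> + a\<^sub>r p\<^sub>r\<close>.\<close>

definition fat_point_ideal ::
    "nat \<Rightarrow> (nat \<Rightarrow> ('k::field, 'n::finite) proj_space) \<Rightarrow> (nat \<Rightarrow> nat) \<Rightarrow> ('k, 'n) mpoly set" where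
  "fat_point_ideal r p a = (\<Inter>j\<in>{1..r}. ideal_power (point_ideal (p j)) (a j))"

end

theory Submission
  imports Defs
begin

text \<open>
  The proof rests on Euler's identity \<open>t F = \<Sum>\<^sub>i x\<^sub>i \<partial>F/\<partial>x\<^sub>i\<close> for a form \<open>F\<close> of degree \<open>t\<close>.
  By the Leibniz rule a derivation maps a power \<open>I\<^sup>a\<^sup>+\<^sup>1\<close> of any ideal into \<open>I\<^sup>a\<close>
  (\<open>derivation_ideal_power\<close>), so differentiating lowers the order of vanishing at a point by at
  most one. If \<open>F \<in> I(Z)\<close>, then all partial derivatives of \<open>F\<close> are in \<open>I(Y)\<close>, because at each
  point of \<open>Z\<close> the multiplicity in \<open>Y\<close> is smaller, and at the other listed points \<open>Y\<close> imposes
  no condition. Hence \<open>t F \<in> R\<^sub>1 I(Y)\<close>, and whenever \<open>t\<close> is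
  invertible in the field, \<open>F \<in> R\<^sub>1 I(Y)\<close> (\<open>form_in_linear_forms_times\<close>). Degree \<open>t = 0\<close> is
  harmless: \<open>Z\<close> is nonempty, so \<open>I(Z)\<close> contains no nonzero constant.

  It remains to generate \<open>I(Z)\<close> by forms whose degrees are zero or invertible in the field. In
  positive characteristic the hypothesis provides them. In characteristic zero any forms will do,
  and they exist because \<open>I(Z)\<close> is a graded ideal: products and intersections of graded
  ideals are graded (\<open>graded_fat_point_ideal\<close>).
\<close>

section \<open>Derivations and powers of ideals\<close>

interpretation self: module "(*) :: 'a::comm_ring_1 \<Rightarrow> 'a \<Rightarrow> 'a"
  by (rule module_self)

abbreviation is_ideal :: "'a::comm_ring_1 set \<Rightarrow> bool" where
  "is_ideal \<equiv> module.subspace (*)"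

lemma is_ideal_generated: "is_ideal (ideal_generated_by S)"
  by (simp add: ideal_generated_by_def self.subspace_span)

lemma generator_in_ideal: "x \<in> S \<Longrightarrow> x \<in> ideal_generated_by S"
  by (simp add: ideal_generated_by_def self.span_base)

lemma ideal_generated_minimal: "S \<subseteq> J \<Longrightarrow> is_ideal J \<Longrightarrow> ideal_generated_by S \<subseteq> J"
  by (simp add: ideal_generated_by_def self.span_minimal)

lemma ideal_generated_induct [consumes 1, case_names zero step]:
  assumes "x \<in> ideal_generated_by S" and "P 0"
    and "\<And>c s y. s \<in> S \<Longrightarrow> y \<in> ideal_generated_by S \<Longrightarrow> P y \<Longrightarrow> P (c * s + y)"
  shows "P x"
proof -
  have "x \<in> self.span S"
    using assms(1) by (simp add: ideal_generated_by_def)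
  then have "x \<in> ideal_generated_by S \<and> P x"
  proof (induction rule: self.span_induct_alt)
    case base
    show ?case
      using assms(2) is_ideal_generated self.subspace_0 by blast
  next
    case (step c s y)
    then show ?case
      using assms(3) is_ideal_generated generator_in_ideal
      by (blast intro: self.subspace_add self.subspace_scale)
  qed
  then show ?thesis ..
qed

lemma mult_in_ideal_product: "s \<in> I \<Longrightarrow> t \<in> J \<Longrightarrow> s * t \<in> ideal_product I J"
  unfolding ideal_product_def by (blast intro: generator_in_ideal)

lemma is_ideal_product: "is_ideal (ideal_product I J)"
  by (simp add: ideal_product_def is_ideal_generated)

lemma ideal_product_subset:
  assumes "is_ideal K" and "\<And>s t. s \<in> I \<Longrightarrow> t \<in> J \<Longrightarrow> s * t \<in> K"
  shows "ideal_product I J \<subseteq> K"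
  unfolding ideal_product_def by (rule ideal_generated_minimal) (use assms in auto)

lemma is_ideal_power: "is_ideal (ideal_power I a)"
  by (cases a) (simp_all add: is_ideal_product self.subspace_UNIV)

lemma ideal_power_antimono:
  assumes "a \<le> b"
  shows "ideal_power I b \<subseteq> ideal_power I a"
  using assms
proof (induction rule: dec_induct)
  case (step b)
  have "ideal_power I (Suc b) \<subseteq> ideal_power I b"
    unfolding ideal_power.simps
    by (rule ideal_product_subset) (simp_all add: is_ideal_power self.subspace_scale)
  with step.IH show ?case by blast
qed simp

lemma ideal_power_subset_base:
  assumes "is_ideal I" and "a > 0"
  shows "ideal_power I a \<subseteq> I"
proof -
  obtain b where b: "a = Suc b"
    using assms(2) gr0_conv_Suc by blast
  have "s * t \<in> I" if "s \<in> I" for s t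
    using self.subspace_scale[OF assms(1) that, of t] by (simp add: mult.commute)
  then show ?thesis
    unfolding b ideal_power.simps by (intro ideal_product_subset assms(1))
qed

lemma is_ideal_fat_point_ideal: "is_ideal (fat_point_ideal r p a)"
  unfolding fat_point_ideal_def by (auto intro!: self.subspace_Inter is_ideal_power)

definition derivation :: "('a::comm_ring_1 \<Rightarrow> 'a) \<Rightarrow> bool" where
  "derivation D \<longleftrightarrow> (\<forall>x y. D (x + y) = D x + D y) \<and> (\<forall>x y. D (x * y) = D x * y + x * D y)"

text \<open>
  In \<open>D (c s) = D c \<cdot> s + c \<cdot> D s\<close> the first term forces the generators themselves, and not only
  their derivatives, to lie in the target ideal.
\<close>

lemma derivation_ideal_generated:
  assumes D: "derivation D" and J: "is_ideal J"
    and S: "\<And>s. s \<in> S \<Longrightarrow> s \<in> J \<and> D s \<in> J"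
    and x: "x \<in> ideal_generated_by S"
  shows "D x \<in> J"
  using x
proof (induction rule: ideal_generated_induct)
  case zero
  have "D 0 + D 0 = D 0 + 0"
    using D unfolding derivation_def by (metis add.right_neutral)
  then have "D 0 = 0"
    by (rule add_left_imp_eq)
  with J show ?case
    by (simp add: self.subspace_0)
next
  case (step c s y)
  have "D (c * s + y) = D c * s + c * D s + D y"
    using D by (simp add: derivation_def)
  then show ?case
    using S[OF step.hyps(1)] step.IH J by (simp add: self.subspace_add self.subspace_scale)
qed

text \<open>
  Induction on \<open>a\<close>: of the two terms of \<open>D (s t) = D s \<cdot> t + s \<cdot> D t\<close>, with \<open>s \<in> I\<close> and
  \<open>t \<in> I\<^sup>a\<close>, the first loses the factor \<open>s\<close>, and the second keeps it while \<open>D t\<close> has lost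
  at most one factor from \<open>I\<close>.
\<close>

lemma derivation_ideal_power:
  assumes D: "derivation D" and "x \<in> ideal_power I (Suc a)"
  shows "D x \<in> ideal_power I a"
  using assms(2)
proof (induction a arbitrary: x)
  case (Suc a)
  let ?S = "{s * t | s t. s \<in> I \<and> t \<in> ideal_power I (Suc a)}"
  have "s * t \<in> ideal_power I (Suc a) \<and> D (s * t) \<in> ideal_power I (Suc a)"
    if s: "s \<in> I" and t: "t \<in> ideal_power I (Suc a)" for s t
  proof
    show st: "s * t \<in> ideal_power I (Suc a)"
      using t by (metis is_ideal_power self.subspace_scale)
    have "D s * t \<in> ideal_power I (Suc a)"
      using t by (metis is_ideal_power self.subspace_scale)
    moreover have "s * D t \<in> ideal_power I (Suc a)"
      using s Suc.IH[OF t] by (simp add: mult_in_ideal_product)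
    moreover have "D (s * t) = D s * t + s * D t"
      using D by (simp add: derivation_def)
    ultimately show "D (s * t) \<in> ideal_power I (Suc a)"
      by (metis is_ideal_power self.subspace_add)
  qed
  then have gens: "z \<in> ideal_power I (Suc a) \<and> D z \<in> ideal_power I (Suc a)" if "z \<in> ?S" for z
    using that by blast
  have "x \<in> ideal_generated_by ?S"
    using Suc.prems by (simp only: ideal_power.simps(2)[of I "Suc a"] ideal_product_def)
  with D is_ideal_power gens show ?case
    by (rule derivation_ideal_generated)
qed simp

section \<open>Partial derivatives and Euler's identity\<close>

lemma poly_mapping_additive_induct [case_names single add]:
  fixes f :: "'a \<Rightarrow>\<^sub>0 'b::comm_monoid_add"
  assumes "\<And>e c. P (Poly_Mapping.single e c)" and "\<And>f g. P f \<Longrightarrow> P g \<Longrightarrow> P (f + g)"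
  shows "P f"
proof (induction f rule: update_induct)
  case const
  show ?case
    using assms(1)[of _ 0] by simp
next
  case (update f e c)
  have "Poly_Mapping.update e c f = Poly_Mapping.single e c + f"
    using update.hyps(1)
    by (intro poly_mapping_eqI) (auto simp: lookup_update lookup_add lookup_single when_def in_keys_iff)
  then show ?case
    using assms update.IH by simp
qed

lift_definition partial_derivative ::
    "'n::finite \<Rightarrow> ('k::comm_semiring_1, 'n) mpoly \<Rightarrow> ('k, 'n) mpoly"
  is "\<lambda>i f e. of_nat (Suc (Poly_Mapping.lookup e i)) * f (e + Poly_Mapping.single i 1)"
proof -
  fix i :: 'n and f :: "('n \<Rightarrow>\<^sub>0 nat) \<Rightarrow> 'k"
  assume "finite {e. f e \<noteq> 0}"
  moreover have "inj (\<lambda>e. e + Poly_Mapping.single i (1::nat))"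
    by (simp add: inj_def)
  ultimately have "finite ((\<lambda>e. e + Poly_Mapping.single i 1) -` {e. f e \<noteq> 0})"
    by (rule finite_vimageI)
  then show "finite {e. of_nat (Suc (Poly_Mapping.lookup e i)) *
      f (e + Poly_Mapping.single i 1) \<noteq> 0}"
    by (rule rev_finite_subset) auto
qed

lemma partial_derivative_add:
  "partial_derivative i (f + g) = partial_derivative i f + partial_derivative i g"
  by (rule poly_mapping_eqI) (simp add: partial_derivative.rep_eq lookup_add distrib_left)

text \<open>
  The truncated exponent \<open>e - \<delta>\<^sub>i\<close> is wrong when \<open>x\<^sub>i\<close> does not occur in the monomial, but then
  the coefficient vanishes.
\<close>

lemma partial_derivative_single:
  "partial_derivative i (Poly_Mapping.single e c) =
    Poly_Mapping.single (e - Poly_Mapping.single i 1) (of_nat (Poly_Mapping.lookup e i) * c)"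
proof (rule poly_mapping_eqI)
  fix e'
  show "Poly_Mapping.lookup (partial_derivative i (Poly_Mapping.single e c)) e' =
    Poly_Mapping.lookup (Poly_Mapping.single (e - Poly_Mapping.single i 1)
      (of_nat (Poly_Mapping.lookup e i) * c)) e'"
  proof (cases "e = e' + Poly_Mapping.single i 1")
    case True
    then show ?thesis
      by (simp add: partial_derivative.rep_eq lookup_add)
  next
    case False
    have "Poly_Mapping.lookup e i = 0" if "e - Poly_Mapping.single i 1 = e'"
    proof (rule ccontr)
      assume "Poly_Mapping.lookup e i \<noteq> 0"
      then have "e = (e - Poly_Mapping.single i 1) + Poly_Mapping.single i 1"
        by (intro poly_mapping_eqI) (auto simp: lookup_add lookup_minus lookup_single when_def)
      with that False show False by simp
    qed
    with False show ?thesis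
      by (auto simp: partial_derivative.rep_eq lookup_single when_def)
  qed
qed

lemma partial_derivative_mult:
  "partial_derivative i (f * g) = partial_derivative i f * g + f * partial_derivative i g"
proof (induction f rule: poly_mapping_additive_induct)
  case (single e c)
  show ?case
  proof (induction g rule: poly_mapping_additive_induct)
    case (single e' c')
    let ?d = "Poly_Mapping.single i (1::nat)"
    have left: "(e - ?d) + e' = e + e' - ?d" if "Poly_Mapping.lookup e i \<noteq> 0"
      using that by (intro poly_mapping_eqI) (auto simp: lookup_add lookup_minus lookup_single when_def)
    have right: "e + (e' - ?d) = e + e' - ?d" if "Poly_Mapping.lookup e' i \<noteq> 0"
      using that by (intro poly_mapping_eqI) (auto simp: lookup_add lookup_minus lookup_single when_def)
    let ?s = "Poly_Mapping.single (e + e' - ?d)"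
    have "partial_derivative i (Poly_Mapping.single e c) * Poly_Mapping.single e' c' =
        ?s (of_nat (Poly_Mapping.lookup e i) * c * c')"
      using left by (cases "Poly_Mapping.lookup e i = 0")
        (simp_all add: partial_derivative_single mult_single)
    moreover have "Poly_Mapping.single e c * partial_derivative i (Poly_Mapping.single e' c') =
        ?s (c * (of_nat (Poly_Mapping.lookup e' i) * c'))"
      using right by (cases "Poly_Mapping.lookup e' i = 0")
        (simp_all add: partial_derivative_single mult_single)
    moreover have "partial_derivative i (Poly_Mapping.single e c * Poly_Mapping.single e' c') =
        ?s (of_nat (Poly_Mapping.lookup e i) * c * c' + c * (of_nat (Poly_Mapping.lookup e' i) * c'))"
      by (simp add: mult_single partial_derivative_single lookup_add algebra_simps)
    ultimately show ?case
      by (simp add: single_add)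
  next
    case (add g h)
    then show ?case
      by (simp add: partial_derivative_add distrib_left add_ac)
  qed
next
  case (add f h)
  then show ?case
    by (simp add: partial_derivative_add distrib_right add_ac)
qed

lemma derivation_partial_derivative:
  "derivation (partial_derivative i :: ('k::comm_ring_1, 'n::finite) mpoly \<Rightarrow> _)"
  by (simp add: derivation_def partial_derivative_add partial_derivative_mult)

lemma Euler_single:
  fixes e :: "'n::finite \<Rightarrow>\<^sub>0 nat"
  shows "(\<Sum>i\<in>UNIV. Poly_Mapping.single (Poly_Mapping.single i 1) 1 *
      partial_derivative i (Poly_Mapping.single e (c::'k::comm_ring_1))) =
    Poly_Mapping.single e (of_nat (monomial_degree e) * c)"
proof -
  have summand: "Poly_Mapping.single (Poly_Mapping.single i 1) 1 *
      partial_derivative i (Poly_Mapping.single e c) =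
    Poly_Mapping.single e (of_nat (Poly_Mapping.lookup e i) * c)" for i
  proof (cases "Poly_Mapping.lookup e i = 0")
    case False
    then have "Poly_Mapping.single i 1 + (e - Poly_Mapping.single i 1) = e"
      by (intro poly_mapping_eqI) (auto simp: lookup_add lookup_minus lookup_single when_def)
    then show ?thesis
      by (simp add: partial_derivative_single mult_single)
  qed (simp add: partial_derivative_single)
  have "(\<Sum>i\<in>A. Poly_Mapping.single e (of_nat (Poly_Mapping.lookup e i) * c)) =
      Poly_Mapping.single e (of_nat (\<Sum>i\<in>A. Poly_Mapping.lookup e i) * c)" for A :: "'n set"
    by (induction A rule: infinite_finite_induct)
      (simp_all add: single_add[symmetric] distrib_right)
  then show ?thesis
    unfolding summand by (simp add: monomial_degree_def)
qed

text \<open>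
  Read coefficientwise, Euler's identity makes sense for sums of forms of different degrees. In
  this form both sides are additive in \<open>f\<close>, so it can be checked on monomials.
\<close>

lemma lookup_Euler:
  fixes f :: "('k::comm_ring_1, 'n::finite) mpoly"
  shows "Poly_Mapping.lookup (\<Sum>i\<in>UNIV. Poly_Mapping.single (Poly_Mapping.single i 1) 1 *
      partial_derivative i f) e = of_nat (monomial_degree e) * Poly_Mapping.lookup f e"
proof (induction f rule: poly_mapping_additive_induct)
  case (single e' c)
  show ?case
    unfolding Euler_single by (simp add: lookup_single when_def)
next
  case (add f g)
  then show ?case
    by (simp add: partial_derivative_add distrib_left sum.distrib lookup_add)
qed

lemma Euler_homogeneous:
  fixes f :: "('k::comm_ring_1, 'n::finite) mpoly"
  assumes "homogeneous t f"
  shows "(\<Sum>i\<in>UNIV. Poly_Mapping.single (Poly_Mapping.single i 1) 1 * partial_derivative i f) =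
    Poly_Mapping.single 0 (of_nat t) * f"
proof (rule poly_mapping_eqI)
  fix e
  have const: "Poly_Mapping.lookup (Poly_Mapping.single 0 a * g) e = a * Poly_Mapping.lookup g e"
    for a :: 'k and g :: "('k, 'n) mpoly"
    by (induction g rule: poly_mapping_additive_induct)
      (simp_all add: mult_single lookup_single when_def distrib_left lookup_add)
  have "of_nat (monomial_degree e) * Poly_Mapping.lookup f e = of_nat t * Poly_Mapping.lookup f e"
    using assms by (cases "e \<in> Poly_Mapping.keys f") (auto simp: homogeneous_def in_keys_iff)
  then show "Poly_Mapping.lookup (\<Sum>i\<in>UNIV. Poly_Mapping.single (Poly_Mapping.single i 1) 1 *
      partial_derivative i f) e = Poly_Mapping.lookup (Poly_Mapping.single 0 (of_nat t) * f) e"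
    by (simp only: lookup_Euler const)
qed

lemma variable_in_linear_forms:
  "Poly_Mapping.single (Poly_Mapping.single i 1) (1::'k::comm_ring_1) \<in>
    (linear_forms :: ('k, 'n::finite) mpoly set)"
  by (simp add: linear_forms_def homogeneous_def monomial_degree_def lookup_single when_def)

section \<open>Graded ideals\<close>

lift_definition homogeneous_component ::
    "nat \<Rightarrow> ('k::zero, 'n::finite) mpoly \<Rightarrow> ('k, 'n) mpoly"
  is "\<lambda>t f e. if monomial_degree e = t then f e else 0"
  by (rule rev_finite_subset) auto

lemma homogeneous_homogeneous_component: "homogeneous t (homogeneous_component t f)"
  by (auto simp: homogeneous_def in_keys_iff homogeneous_component.rep_eq split: if_splits)

lemma homogeneous_component_homogeneous:
  assumes "homogeneous s f"
  shows "homogeneous_component t f = (if t = s then f else 0)"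
  using assms by (intro poly_mapping_eqI)
    (auto simp: homogeneous_component.rep_eq homogeneous_def in_keys_iff)

lemma homogeneous_component_zero [simp]: "homogeneous_component t 0 = 0"
  by (rule poly_mapping_eqI) (simp add: homogeneous_component.rep_eq)

lemma homogeneous_component_add:
  fixes f g :: "('k::comm_monoid_add, 'n::finite) mpoly"
  shows "homogeneous_component t (f + g) = homogeneous_component t f + homogeneous_component t g"
  by (rule poly_mapping_eqI) (simp add: homogeneous_component.rep_eq lookup_add)

lemma sum_homogeneous_components:
  fixes f :: "('k::comm_monoid_add, 'n::finite) mpoly"
  shows "(\<Sum>t\<in>monomial_degree ` Poly_Mapping.keys f. homogeneous_component t f) = f"
  by (rule poly_mapping_eqI)
    (auto simp: lookup_sum homogeneous_component.rep_eq sum.delta in_keys_iff image_iff)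

lemma homogeneous_component_mult:
  fixes f g :: "('k::comm_ring_1, 'n::finite) mpoly"
  shows "homogeneous_component t (f * g) =
    (\<Sum>s\<le>t. homogeneous_component s f * homogeneous_component (t - s) g)"
proof (induction f rule: poly_mapping_additive_induct)
  case (single e c)
  show ?case
  proof (induction g rule: poly_mapping_additive_induct)
    case (single e' c')
    have hom: "homogeneous (monomial_degree a) (Poly_Mapping.single a b)"
      for a :: "'n \<Rightarrow>\<^sub>0 nat" and b :: 'k
      by (simp add: homogeneous_def)
    have deg: "monomial_degree (e + e') = monomial_degree e + monomial_degree e'"
      by (simp add: monomial_degree_def lookup_add sum.distrib)
    have "(\<Sum>s\<le>t. homogeneous_component s (Poly_Mapping.single e c) *
        homogeneous_component (t - s) (Poly_Mapping.single e' c')) =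
      (\<Sum>s\<le>t. if s = monomial_degree e then
        (if t - s = monomial_degree e' then Poly_Mapping.single (e + e') (c * c') else 0) else 0)"
      by (intro sum.cong) (auto simp: homogeneous_component_homogeneous[OF hom] mult_single)
    also have "\<dots> = homogeneous_component t (Poly_Mapping.single e c * Poly_Mapping.single e' c')"
      by (auto simp: mult_single homogeneous_component_homogeneous[OF hom] deg)
    finally show ?case ..
  next
    case (add g h)
    then show ?case
      by (simp add: homogeneous_component_add distrib_left sum.distrib)
  qed
next
  case (add f h)
  then show ?case
    by (simp add: homogeneous_component_add distrib_right sum.distrib)
qed

definition graded :: "('k::comm_ring_1, 'n::finite) mpoly set \<Rightarrow> bool" where
  "graded J \<longleftrightarrow> (\<forall>f\<in>J. \<forall>t. homogeneous_component t f \<in> J)"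

text \<open>
  The components of \<open>c s\<close> are combinations of the components of \<open>s\<close>, so gradedness need only be
  tested on generators, which need not be homogeneous themselves.
\<close>

lemma graded_ideal_generated:
  assumes S: "\<And>s t. s \<in> S \<Longrightarrow> homogeneous_component t s \<in> ideal_generated_by S"
  shows "graded (ideal_generated_by S)"
  unfolding graded_def
proof (intro ballI allI)
  fix f t
  assume "f \<in> ideal_generated_by S"
  then show "homogeneous_component t f \<in> ideal_generated_by S"
  proof (induction arbitrary: t rule: ideal_generated_induct)
    case zero
    show ?case
      using is_ideal_generated self.subspace_0 by auto
  next
    case (step c s y)
    have "homogeneous_component t (c * s) \<in> ideal_generated_by S"
      unfolding homogeneous_component_mult
      by (intro self.subspace_sum self.subspace_scale is_ideal_generated S step.hyps)
    then show ?case
      using step.IH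
      by (simp add: homogeneous_component_add self.subspace_add is_ideal_generated)
  qed
qed

lemma graded_ideal_product:
  assumes I: "graded I" and J: "graded J"
  shows "graded (ideal_product I J)"
  unfolding ideal_product_def
proof (rule graded_ideal_generated)
  fix z t
  assume "z \<in> {x * y | x y. x \<in> I \<and> y \<in> J}"
  then obtain x y where z: "z = x * y" "x \<in> I" "y \<in> J" by blast
  have "homogeneous_component t (x * y) \<in> ideal_product I J"
    unfolding homogeneous_component_mult
    by (intro self.subspace_sum is_ideal_product mult_in_ideal_product)
      (use z I J in \<open>auto simp: graded_def\<close>)
  with z show "homogeneous_component t z \<in>
      ideal_generated_by {x * y | x y. x \<in> I \<and> y \<in> J}"
    by (simp add: ideal_product_def)
qed

lemma forms_vanishing_at_homogeneous:
  "f \<in> forms_vanishing_at P \<Longrightarrow> \<exists>t. homogeneous t f"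
  by transfer auto

lemma graded_point_ideal: "graded (point_ideal P)"
  unfolding point_ideal_def
proof (rule graded_ideal_generated)
  fix s t
  assume s: "s \<in> forms_vanishing_at P"
  then obtain u where "homogeneous u s"
    using forms_vanishing_at_homogeneous by blast
  then show "homogeneous_component t s \<in> ideal_generated_by (forms_vanishing_at P)"
    using generator_in_ideal[OF s]
      self.subspace_0[OF is_ideal_generated[of "forms_vanishing_at P"]]
    by (simp add: homogeneous_component_homogeneous)
qed

lemma graded_ideal_power: "graded I \<Longrightarrow> graded (ideal_power I a)"
  by (induction a) (simp_all add: graded_ideal_product, simp add: graded_def)

lemma graded_fat_point_ideal: "graded (fat_point_ideal r p a)"
  using graded_ideal_power[OF graded_point_ideal]
  by (fastforce simp: graded_def fat_point_ideal_def)

section \<open>Fat points\<close>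

text \<open>
  A form of degree zero is a constant, equal to its value at every vector, and a form of positive
  degree has no constant term.
\<close>

lemma constant_component_vanishing_form:
  assumes f: "homogeneous t f" and ev: "eval_at v f = 0"
  shows "homogeneous_component 0 f = 0"
proof (cases "t = 0")
  case True
  have "e = 0" if "e \<in> Poly_Mapping.keys f" for e
  proof (rule poly_mapping_eqI)
    fix i
    have "(\<Sum>i\<in>UNIV. Poly_Mapping.lookup e i) = 0"
      using f that True by (simp add: homogeneous_def monomial_degree_def)
    then show "Poly_Mapping.lookup e i = Poly_Mapping.lookup 0 i"
      by simp
  qed
  then have "Poly_Mapping.keys f = {} \<or> Poly_Mapping.keys f = {0}" by blast
  then have "Poly_Mapping.keys f = {}"
  proof
    assume keys: "Poly_Mapping.keys f = {0}"
    then have "Poly_Mapping.lookup f 0 = 0"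
      using ev by (simp add: eval_at_def)
    then show ?thesis
      using keys by (metis in_keys_iff singletonI)
  qed
  then have "f = 0" by simp
  then show ?thesis by simp
next
  case False
  with f show ?thesis
    by (simp add: homogeneous_component_homogeneous)
qed

lemma constant_component_forms_vanishing_at:
  "f \<in> forms_vanishing_at P \<Longrightarrow> homogeneous_component 0 f = 0"
  by transfer (auto intro: constant_component_vanishing_form)

lemma constant_component_point_ideal:
  assumes "f \<in> point_ideal P"
  shows "homogeneous_component 0 f = 0"
  using assms unfolding point_ideal_def
  by (induction rule: ideal_generated_induct)
    (simp_all add: homogeneous_component_add homogeneous_component_mult
      constant_component_forms_vanishing_at)

lemma partial_derivative_fat_point_ideal:
  assumes "f \<in> fat_point_ideal r p m'"
    and "\<forall>j\<in>{1..r}. m j \<le> m' j - 1"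
  shows "partial_derivative i f \<in> fat_point_ideal r p m"
  unfolding fat_point_ideal_def
proof
  fix j assume j: "j \<in> {1..r}"
  let ?I = "point_ideal (p j)"
  have "partial_derivative i f \<in> ideal_power ?I (m' j - 1)"
  proof (cases "m' j = 0")
    case False
    then have "f \<in> ideal_power ?I (Suc (m' j - 1))"
      using assms(1) j by (simp add: fat_point_ideal_def)
    then show ?thesis
      by (rule derivation_ideal_power[OF derivation_partial_derivative])
  qed simp
  then show "partial_derivative i f \<in> ideal_power ?I (m j)"
    using assms(2) j ideal_power_antimono by blast
qed

text \<open>Division of Euler's identity by the degree.\<close>

lemma form_in_linear_forms_times:
  fixes f :: "('k::field, 'n::finite) mpoly"
  assumes f: "homogeneous t f" and t: "of_nat t \<noteq> (0::'k)"
    and D: "\<And>i. partial_derivative i f \<in> J"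
  shows "f \<in> ideal_product linear_forms J"
proof -
  have "(\<Sum>i\<in>UNIV. Poly_Mapping.single (Poly_Mapping.single i 1) 1 * partial_derivative i f)
      \<in> ideal_product linear_forms J"
    by (intro self.subspace_sum is_ideal_product mult_in_ideal_product variable_in_linear_forms D)
  then have "Poly_Mapping.single 0 (of_nat t) * f \<in> ideal_product linear_forms J"
    by (simp only: Euler_homogeneous[OF f])
  then have "Poly_Mapping.single 0 (inverse (of_nat t)) * (Poly_Mapping.single 0 (of_nat t) * f)
      \<in> ideal_product linear_forms J"
    by (rule self.subspace_scale[OF is_ideal_product])
  with t show ?thesis
    by (simp add: mult.assoc[symmetric] mult_single del: single_of_nat)
qed

lemma total_degree_homogeneous:
  assumes "homogeneous t f" and "f \<noteq> 0"
  shows "total_degree f = t"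
proof -
  have "monomial_degree ` Poly_Mapping.keys f = {t}"
    using assms by (auto simp: homogeneous_def simp flip: keys_eq_empty)
  then show ?thesis
    by (simp add: total_degree_def)
qed

theorem proposition3p1:
  fixes r :: nat
    and p :: "nat \<Rightarrow> ('k::alg_closed_field, 'n::finite) proj_space"
    and m m' :: "nat \<Rightarrow> nat"
  assumes mult: "\<forall>i\<in>{1..r}. m' i > 0 \<longrightarrow> m' i > m i"
    and supp: "\<forall>i\<in>{1..r}. m' i = 0 \<longrightarrow> m i = 0"
    and nonempty: "\<exists>i\<in>{1..r}. m' i > 0"
    and char: "CHAR('k) = 0 \<or>
      (\<exists>G. minimal_homogeneous_generators G (fat_point_ideal r p m') \<and>
           (\<forall>g\<in>G. total_degree g < CHAR('k)))"
  shows "fat_point_ideal r p m' \<subseteq> ideal_product linear_forms (fat_point_ideal r p m)"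
proof -
  let ?Z = "fat_point_ideal r p m'" and ?Y = "fat_point_ideal r p m"
  let ?RY = "ideal_product linear_forms ?Y"
  have "\<forall>j\<in>{1..r}. m j \<le> m' j - 1"
    using mult supp by fastforce
  then have D: "partial_derivative i f \<in> ?Y" if "f \<in> ?Z" for i f
    using that partial_derivative_fat_point_ideal by blast
  have const: "homogeneous_component 0 f = 0" if f: "f \<in> ?Z" for f
  proof -
    obtain j where "j \<in> {1..r}" "m' j > 0"
      using nonempty by blast
    then have "f \<in> point_ideal (p j)"
      using f ideal_power_subset_base[of "point_ideal (p j)" "m' j"]
      by (auto simp: fat_point_ideal_def point_ideal_def is_ideal_generated)
    then show ?thesis
      by (rule constant_component_point_ideal)
  qed
  have form: "f \<in> ?RY"
    if f: "f \<in> ?Z" "homogeneous t f" and t: "CHAR('k) = 0 \<or> t < CHAR('k)" for f t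
  proof (cases "t = 0")
    case True
    then have "f = 0"
      using const[OF f(1)] f(2) by (simp add: homogeneous_component_homogeneous)
    then show ?thesis
      by (simp add: self.subspace_0 is_ideal_product)
  next
    case False
    then have "of_nat t \<noteq> (0::'k)"
      using t by (auto simp: of_nat_eq_0_iff_char_dvd dest: dvd_imp_le)
    with f show ?thesis
      by (blast intro: form_in_linear_forms_times D)
  qed
  from char show ?thesis
  proof
    assume char0: "CHAR('k) = 0"
    show ?thesis
    proof
      fix f assume f: "f \<in> ?Z"
      have "homogeneous_component t f \<in> ?RY" for t
        using f graded_fat_point_ideal form[OF _ homogeneous_homogeneous_component] char0
        by (metis graded_def)
      then have "(\<Sum>t\<in>monomial_degree ` Poly_Mapping.keys f. homogeneous_component t f) \<in> ?RY"
        by (intro self.subspace_sum is_ideal_product)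
      then show "f \<in> ?RY"
        by (simp only: sum_homogeneous_components)
    qed
  next
    assume "\<exists>G. minimal_homogeneous_generators G ?Z \<and> (\<forall>g\<in>G. total_degree g < CHAR('k))"
    then obtain G where hom: "\<forall>g\<in>G. \<exists>t. homogeneous t g" and gen: "ideal_generated_by G = ?Z"
      and deg: "\<forall>g\<in>G. total_degree g < CHAR('k)"
      by (auto simp: minimal_homogeneous_generators_def)
    have "g \<in> ?RY" if g: "g \<in> G" for g
    proof (cases "g = 0")
      case True
      then show ?thesis
        by (simp add: self.subspace_0 is_ideal_product)
    next
      case False
      obtain t where "homogeneous t g"
        using hom g by blast
      moreover from this have "t < CHAR('k)"
        using total_degree_homogeneous[OF _ False] deg g by blast
      moreover have "g \<in> ?Z"
        using generator_in_ideal[OF g] gen by simp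
      ultimately show ?thesis
        by (blast intro: form)
    qed
    then have "ideal_generated_by G \<subseteq> ?RY"
      by (intro ideal_generated_minimal is_ideal_product) blast
    with gen show ?thesis by simp
  qed
qed

end
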